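(* Let $X$ be a measurable space, let $n \ge 1$ be an integer, and let $f : X^n \to \mathbb{R}$ be a bounded measurable function. Then $$\sup_\mu \mathbb{E}_{\mu^{\otimes n}}[f] = \lim_{m \to \infty} \; \sup_{x_1, \dots, x_m \in X} \; \frac{1}{m(m-1)\cdots(m-n+1)} \sum_{i : [n] \hookrightarrow [m]} f(x_{i(1)}, \dots, x_{i(n)}),$$ where the supremum on the left-hand side is over all probability measures $\mu$ on $X$, and where the limit on the right-hand side is over a sequence (indexed by integers $m \ge n$) that is monotonically nonincreasing in $m$.
   Context: $[k] = \{1, \dots, k\}$. $X^n$ carries the product $\sigma$-algebra, $\mu^{\otimes n}$ denotes the $n$-fold product measure on $X^n$, and $\mathbb{E}_{\mu^{\otimes n}}[f]$ is the expectation (integral) of $f$ with respect to it. The sum is over all injective maps $i : [n] \hookrightarrow [m]$. The points $x_1, \dots, x_m$ are not required to be distinct. *)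

theory Defs
  imports "HOL-Probability.Probability"
begin

text \<open>
  \<open>X\<^sup>k\<close> is \<open>PiM {1..k} (\<lambda>_. M)\<close>: its points are functions on \<open>{1..k}\<close>,
  extensional outside. Hence the index maps \<open>i\<close> range over extensional functions
  (so that each map is counted once), and the composite \<open>x \<circ> i\<close> is restricted to \<open>{1..n}\<close>.
\<close>

definition injections :: "nat \<Rightarrow> nat \<Rightarrow> (nat \<Rightarrow> nat) set" where
  "injections n m = {i \<in> {1..n} \<rightarrow>\<^sub>E {1..m}. inj_on i {1..n}}"

definition injection_average :: "nat \<Rightarrow> ((nat \<Rightarrow> 'a) \<Rightarrow> real) \<Rightarrow> nat \<Rightarrow> (nat \<Rightarrow> 'a) \<Rightarrow> real" where
  "injection_average n f m x =
     1 / (\<Prod>k<n. real m - real k) * (\<Sum>i\<in>injections n m. f (\<lambda>k\<in>{1..n}. x (i k)))"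

text \<open>
  Suprema are taken in \<open>ereal\<close>, so they carry no junk value: they are finite when
  \<open>space M\<close> is nonempty and \<open>f\<close> is bounded, and \<open>-\<infinity>\<close> over the empty set.
\<close>

definition sup_injection_average ::
  "'a measure \<Rightarrow> nat \<Rightarrow> ((nat \<Rightarrow> 'a) \<Rightarrow> real) \<Rightarrow> nat \<Rightarrow> ereal" where
  "sup_injection_average M n f m =
     (SUP x \<in> space (PiM {1..m} (\<lambda>_. M)). ereal (injection_average n f m x))"

definition sup_product_expectation ::
  "'a measure \<Rightarrow> nat \<Rightarrow> ((nat \<Rightarrow> 'a) \<Rightarrow> real) \<Rightarrow> ereal" where
  "sup_product_expectation M n f =
     (SUP \<mu> \<in> {\<mu>. prob_space \<mu> \<and> sets \<mu> = sets M}.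
        ereal (\<integral>x. f x \<partial>(PiM {1..n} (\<lambda>_. \<mu>))))"

end

theory Submission
  imports Defs "HOL-Real_Asymp.Real_Asymp"
begin

text \<open>
  Integrating the injection average \<open>a\<^sub>m\<close> over \<open>\<mu>\<^bsup>\<otimes>m\<^esup>\<close> gives \<open>\<E>f\<close>, because an injection pulls
  independent samples back to independent samples; hence \<open>sup a\<^sub>m\<close> dominates the left-hand side.
  Conversely, the expectation of \<open>f\<close> under the \<open>n\<close>-th power of the empirical measure of
  \<open>x\<^sub>1, \<dots>, x\<^sub>m\<close> is the average of \<open>f\<close> over all maps \<open>[n] \<rightarrow> [m]\<close>. The proportion of injective
  maps tends to 1, so \<open>a\<^sub>m\<close> exceeds this expectation by an error tending to 0, uniformly in \<open>x\<close>.
  Monotonicity holds because \<open>a\<^sub>m\<^sub>+\<^sub>1(x)\<close> is the average of the \<open>a\<^sub>m\<close> at the \<open>m + 1\<close> tuples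
  obtained from \<open>x\<close> by deleting one coordinate.
\<close>

section \<open>Uniform measures on finite powers\<close>

text \<open>On a finite set with all subsets measurable, a measure is determined by its point
  masses. A singleton is a box of singletons, so its product mass is
  \<open>(1 / card A) ^ card I\<close>, the reciprocal of the number of maps.\<close>

lemma PiM_uniform_count_measure:
  assumes "finite I" "finite A" "A \<noteq> {}"
  shows "PiM I (\<lambda>_. uniform_count_measure A) = uniform_count_measure (I \<rightarrow>\<^sub>E A)"
proof (rule measure_eqI_finite)
  interpret prob_space "uniform_count_measure A"
    using assms by (intro prob_space_uniform_count_measure)
  interpret product_sigma_finite "\<lambda>_. uniform_count_measure A" ..
  have "sets (PiM I (\<lambda>_. uniform_count_measure A)) = sets (PiM I (\<lambda>_. count_space A))"
    by (intro sets_PiM_cong sets_uniform_count_measure_count_space refl)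
  also have "\<dots> = Pow (I \<rightarrow>\<^sub>E A)"
    using assms by (simp add: count_space_PiM_finite countable_finite)
  finally show "sets (PiM I (\<lambda>_. uniform_count_measure A)) = Pow (I \<rightarrow>\<^sub>E A)" .
  show fin: "finite (I \<rightarrow>\<^sub>E A)"
    using assms by (intro finite_PiE)
  fix a assume a: "a \<in> I \<rightarrow>\<^sub>E A"
  have "emeasure (PiM I (\<lambda>_. uniform_count_measure A)) {a} =
      emeasure (PiM I (\<lambda>_. uniform_count_measure A)) (PiE I (\<lambda>i. {a i}))"
    using a by (simp add: PiE_singleton PiE_iff)
  also have "\<dots> = (\<Prod>i\<in>I. emeasure (uniform_count_measure A) {a i})"
    using a assms by (intro emeasure_PiM) (auto simp: sets_uniform_count_measure)
  also have "\<dots> = (\<Prod>i\<in>I. ennreal (1 / real (card A)))"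
  proof (intro prod.cong refl)
    fix i assume "i \<in> I"
    then have "{a i} \<subseteq> A" using a by auto
    then show "emeasure (uniform_count_measure A) {a i} = ennreal (1 / real (card A))"
      using emeasure_uniform_count_measure[of A "{a i}"] assms by simp
  qed
  also have "\<dots> = ennreal (1 / real (card (I \<rightarrow>\<^sub>E A)))"
    using assms by (simp add: ennreal_power power_one_over card_funcsetE)
  also have "\<dots> = emeasure (uniform_count_measure (I \<rightarrow>\<^sub>E A)) {a}"
    using a fin by (simp add: emeasure_uniform_count_measure)
  finally show "emeasure (PiM I (\<lambda>_. uniform_count_measure A)) {a} = \<dots>" .
qed (simp add: sets_uniform_count_measure)

section \<open>Reindexing and counting injections\<close>

text \<open>Composing with the inverse of \<open>s\<close> undoes the map; the restriction to
  \<open>I\<close> keeps the composites extensional, so that they cancel as functions.\<close>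

lemma bij_betw_postcompose_injections:
  assumes s: "bij_betw s A B"
  shows "bij_betw (\<lambda>i. \<lambda>k\<in>I. s (i k))
    {i \<in> I \<rightarrow>\<^sub>E A. inj_on i I} {i \<in> I \<rightarrow>\<^sub>E B. inj_on i I}"
proof (rule bij_betw_byWitness[where f' = "\<lambda>i. \<lambda>k\<in>I. the_inv_into A s (i k)"])
  let ?t = "the_inv_into A s"
  have inj: "inj_on s A" and img: "s ` A = B"
    using s by (auto simp: bij_betw_def)
  have t: "bij_betw ?t B A"
    by (rule bij_betw_the_inv_into[OF s])
  show "\<forall>i\<in>{i \<in> I \<rightarrow>\<^sub>E A. inj_on i I}. (\<lambda>k\<in>I. ?t ((\<lambda>k\<in>I. s (i k)) k)) = i"
    using the_inv_into_f_f[OF inj] by (auto simp: fun_eq_iff PiE_iff extensional_def Pi_iff)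
  show "\<forall>i\<in>{i \<in> I \<rightarrow>\<^sub>E B. inj_on i I}. (\<lambda>k\<in>I. s ((\<lambda>k\<in>I. ?t (i k)) k)) = i"
    using f_the_inv_into_f[OF inj] img by (auto simp: fun_eq_iff PiE_iff extensional_def Pi_iff)
  \<comment> \<open>Stated for an arbitrary bijection between arbitrary types, since it serves both
    \<open>s\<close> and its inverse.\<close>
  have comp: "(\<lambda>k\<in>I. h (i k)) \<in> {i \<in> I \<rightarrow>\<^sub>E D. inj_on i I}"
    if h: "bij_betw h C D" and i: "i \<in> {i \<in> I \<rightarrow>\<^sub>E C. inj_on i I}"
    for h :: "'x \<Rightarrow> 'y" and C D and i
  proof -
    have "i ` I \<subseteq> C" "inj_on i I" using i by (auto simp: PiE_iff)
    then have "inj_on (\<lambda>k. h (i k)) I"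
      using comp_inj_on[of i I h] inj_on_subset[of h C] h by (auto simp: bij_betw_def comp_def)
    then show ?thesis using i bij_betwE[OF h] by (auto simp: PiE_iff)
  qed
  show "(\<lambda>i. \<lambda>k\<in>I. s (i k)) ` {i \<in> I \<rightarrow>\<^sub>E A. inj_on i I} \<subseteq> {i \<in> I \<rightarrow>\<^sub>E B. inj_on i I}"
    by (intro image_subsetI comp[OF s])
  show "(\<lambda>i. \<lambda>k\<in>I. ?t (i k)) ` {i \<in> I \<rightarrow>\<^sub>E B. inj_on i I} \<subseteq> {i \<in> I \<rightarrow>\<^sub>E A. inj_on i I}"
    by (intro image_subsetI comp[OF t])
qed

lemma finite_injections [simp]: "finite (injections n m)"
  by (rule finite_subset[of _ "{1..n} \<rightarrow>\<^sub>E {1..m}"]) (auto simp: injections_def intro: finite_PiE)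

lemma falling_factorial_pos:
  assumes "n \<le> m"
  shows "(\<Prod>k<n. real m - real k) > 0"
  using assms by (intro prod_pos) auto

lemma card_injections:
  assumes "n \<le> m"
  shows "real (card (injections n m)) = (\<Prod>k<n. real m - real k)"
proof -
  have "card (injections n m) = prod ((-) m) {0..<n}"
    unfolding injections_def by (subst card_inj_on_subset_funcset) auto
  also have "real \<dots> = (\<Prod>k<n. real m - real k)"
    unfolding of_nat_prod atLeast0LessThan using assms
    by (intro prod.cong) (auto simp: of_nat_diff)
  finally show ?thesis .
qed

text \<open>Both sides are the product of the \<open>n + 1\<close> consecutive numbers from
  \<open>m + 1\<close> downwards, with the last or the first factor split off.\<close>

lemma falling_factorial_Suc:
  assumes "n \<le> m"
  shows "(\<Prod>k<n. real (Suc m) - real k) * (real (Suc m) - real n) =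
    real (Suc m) * (\<Prod>k<n. real m - real k)"
proof -
  have "(\<Prod>k<Suc n. real (Suc m) - real k) = real (Suc m) * (\<Prod>k<n. real m - real k)"
    by (subst prod.lessThan_Suc_shift) simp
  then show ?thesis by simp
qed

text \<open>Double counting of pairs of an injection \<open>i\<close> into \<open>{1..Suc m}\<close>
  and a value \<open>j\<close> that it misses: for fixed \<open>j\<close> these are the injections
  into \<open>{1..m}\<close> followed by \<open>s j\<close>, and for fixed \<open>i\<close> there
  are \<open>m + 1 - n\<close> choices of \<open>j\<close>.\<close>

lemma sum_injections_Suc:
  fixes g :: "(nat \<Rightarrow> nat) \<Rightarrow> real"
  assumes "n \<le> m"
    and s: "\<And>j. j \<in> {1..Suc m} \<Longrightarrow> bij_betw (s j) {1..m} ({1..Suc m} - {j})"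
  shows "(\<Sum>j\<in>{1..Suc m}. \<Sum>i\<in>injections n m. g (\<lambda>k\<in>{1..n}. s j (i k))) =
    (real (Suc m) - real n) * (\<Sum>i\<in>injections n (Suc m). g i)"
proof -
  have reindex: "(\<Sum>i\<in>injections n m. g (\<lambda>k\<in>{1..n}. s j (i k))) =
      (\<Sum>i | i \<in> injections n (Suc m) \<and> j \<notin> i ` {1..n}. g i)" if j: "j \<in> {1..Suc m}" for j
  proof (rule sum.reindex_bij_betw)
    have "{i \<in> {1..n} \<rightarrow>\<^sub>E {1..Suc m} - {j}. inj_on i {1..n}} =
        {i. i \<in> injections n (Suc m) \<and> j \<notin> i ` {1..n}}"
      by (auto simp: injections_def PiE_iff)
    then show "bij_betw (\<lambda>i. \<lambda>k\<in>{1..n}. s j (i k)) (injections n m)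
        {i. i \<in> injections n (Suc m) \<and> j \<notin> i ` {1..n}}"
      using bij_betw_postcompose_injections[OF s[OF j], of "{1..n}"] by (simp add: injections_def)
  qed
  have "(\<Sum>j\<in>{1..Suc m}. \<Sum>i\<in>injections n m. g (\<lambda>k\<in>{1..n}. s j (i k))) =
      (\<Sum>j\<in>{1..Suc m}. \<Sum>i | i \<in> injections n (Suc m) \<and> j \<notin> i ` {1..n}. g i)"
    by (intro sum.cong refl reindex)
  also have "\<dots> = (\<Sum>i\<in>injections n (Suc m). \<Sum>j | j \<in> {1..Suc m} \<and> j \<notin> i ` {1..n}. g i)"
    by (rule sum.swap_restrict) auto
  also have "\<dots> = (\<Sum>i\<in>injections n (Suc m). (real (Suc m) - real n) * g i)"
  proof (intro sum.cong refl)
    fix i assume "i \<in> injections n (Suc m)"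
    then have sub: "i ` {1..n} \<subseteq> {1..Suc m}" and inj: "inj_on i {1..n}"
      by (auto simp: injections_def PiE_iff)
    have "card {j. j \<in> {1..Suc m} \<and> j \<notin> i ` {1..n}} = card ({1..Suc m} - i ` {1..n})"
      by (rule arg_cong[of _ _ card]) auto
    also have "\<dots> = Suc m - n"
      using sub inj by (subst card_Diff_subset) (auto simp: card_image)
    finally show "(\<Sum>j | j \<in> {1..Suc m} \<and> j \<notin> i ` {1..n}. g i) = (real (Suc m) - real n) * g i"
      using assms(1) by (simp add: of_nat_diff)
  qed
  finally show ?thesis by (simp add: sum_distrib_left)
qed

section \<open>Monotonicity in \<open>m\<close>\<close>

text \<open>The bijection \<open>s j\<close> lists the coordinates that survive the deletion of
  \<open>j\<close>. Any such listing serves, since a sum over all injections ignores its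
  order.\<close>

lemma injection_average_Suc:
  assumes "n \<le> m"
    and s: "\<And>j. j \<in> {1..Suc m} \<Longrightarrow> bij_betw (s j) {1..m} ({1..Suc m} - {j})"
  shows "injection_average n f (Suc m) x =
    (\<Sum>j\<in>{1..Suc m}. injection_average n f m (\<lambda>k\<in>{1..m}. x (s j k))) / real (Suc m)"
proof -
  define D where "D = (\<Prod>k<n. real m - real k)"
  define D' where "D' = (\<Prod>k<n. real (Suc m) - real k)"
  define T where "T = (\<Sum>i\<in>injections n (Suc m). f (\<lambda>k\<in>{1..n}. x (i k)))"
  \<comment> \<open>Choosing from the shortened tuple along \<open>i\<close> is choosing from
    \<open>x\<close> along \<open>s j\<close> after \<open>i\<close>; the restriction to
    \<open>{1..m}\<close> is invisible because \<open>i\<close> takes its values there.\<close>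
  have avg: "injection_average n f m (\<lambda>k\<in>{1..m}. x (s j k)) =
      1 / D * (\<Sum>i\<in>injections n m. f (\<lambda>k\<in>{1..n}. x ((\<lambda>k\<in>{1..n}. s j (i k)) k)))" for j
    unfolding injection_average_def D_def
    by (intro arg_cong2[of _ _ _ _ "(*)"] sum.cong refl arg_cong[of _ _ f])
      (auto simp: injections_def PiE_iff fun_eq_iff restrict_def)
  have "(\<Sum>j\<in>{1..Suc m}. injection_average n f m (\<lambda>k\<in>{1..m}. x (s j k))) =
      1 / D * ((real (Suc m) - real n) * T)"
    unfolding avg sum_distrib_left[symmetric] T_def
    by (subst sum_injections_Suc[OF assms]) (auto simp del: of_nat_Suc)
  then have "(\<Sum>j\<in>{1..Suc m}. injection_average n f m (\<lambda>k\<in>{1..m}. x (s j k))) / real (Suc m) =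
      (real (Suc m) - real n) * T / (real (Suc m) * D)"
    by simp
  also have "real (Suc m) * D = (real (Suc m) - real n) * D'"
    unfolding D_def D'_def using falling_factorial_Suc[OF assms(1)] by (simp only: mult.commute)
  \<comment> \<open>The cancelled factor \<open>m + 1 - n\<close> is nonzero because
    \<open>n \<le> m\<close>.\<close>
  also have "(real (Suc m) - real n) * T / \<dots> = T / D'"
    using assms(1) by (intro mult_divide_mult_cancel_left) simp
  also have "\<dots> = injection_average n f (Suc m) x"
    by (simp add: injection_average_def D'_def T_def)
  finally show ?thesis ..
qed

text \<open>An average never exceeds its largest term, so among the tuples with one coordinate
  deleted some \<open>y j\<close> has an injection average at least that of
  \<open>x\<close>.\<close>

lemma sup_injection_average_Suc:
  assumes "n \<le> m"
  shows "sup_injection_average M n f (Suc m) \<le> sup_injection_average M n f m"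
  unfolding sup_injection_average_def[of M n f "Suc m"]
proof (rule SUP_least)
  fix x assume x: "x \<in> space (PiM {1..Suc m} (\<lambda>_. M))"
  have "\<forall>j\<in>{1..Suc m}. \<exists>s. bij_betw s {1..m} ({1..Suc m} - {j})"
    by (intro ballI finite_same_card_bij) auto
  then obtain s where s: "\<And>j. j \<in> {1..Suc m} \<Longrightarrow> bij_betw (s j) {1..m} ({1..Suc m} - {j})"
    by metis
  define y where "y j = (\<lambda>k\<in>{1..m}. x (s j k))" for j
  have y: "y j \<in> space (PiM {1..m} (\<lambda>_. M))" if "j \<in> {1..Suc m}" for j
    using x bij_betwE[OF s[OF that]] by (auto simp: y_def space_PiM PiE_iff)
  have "\<exists>j\<in>{1..Suc m}. injection_average n f (Suc m) x \<le> injection_average n f m (y j)"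
  proof (rule ccontr)
    assume "\<not> ?thesis"
    then have "(\<Sum>j\<in>{1..Suc m}. injection_average n f m (y j)) <
        (\<Sum>j\<in>{1..Suc m}. injection_average n f (Suc m) x)"
      by (intro sum_strict_mono) (auto simp: not_le)
    then show False
      using injection_average_Suc[OF assms s, of f x] by (simp add: y_def field_simps)
  qed
  then obtain j where "j \<in> {1..Suc m}"
      "injection_average n f (Suc m) x \<le> injection_average n f m (y j)" by blast
  then show "ereal (injection_average n f (Suc m) x) \<le> sup_injection_average M n f m"
    unfolding sup_injection_average_def by (intro SUP_upper2[OF y]) auto
qed

lemma antimono_sup_injection_average:
  "antimono_on {n..} (sup_injection_average M n f)"
proof (rule monotone_onI)
  fix a b :: nat assume a: "a \<in> {n..}" and "a \<le> b"
  from \<open>a \<le> b\<close> show "sup_injection_average M n f b \<le> sup_injection_average M n f a"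
  proof (induction b rule: dec_induct)
    case (step b)
    then show ?case
      using a sup_injection_average_Suc[of n b M f] by (auto intro: order_trans)
  qed simp
qed

section \<open>Product expectations as lower bounds\<close>

lemma restrict_comp_in_space_PiM:
  assumes "x \<in> space (PiM J (\<lambda>_. M))" "i \<in> I \<rightarrow> J"
  shows "(\<lambda>k\<in>I. x (i k)) \<in> space (PiM I (\<lambda>_. M))"
  using assms by (auto simp: space_PiM PiE_iff)

text \<open>A random variable cannot lie strictly below its mean everywhere, and the injection
  average of \<open>m\<close> independent samples has mean \<open>E\<close>. The bound
  \<open>B\<close> supplies integrability.\<close>

lemma product_expectation_le_sup_injection_average:
  assumes f: "f \<in> borel_measurable (PiM {1..n} (\<lambda>_. M))"
    and B: "\<And>y. y \<in> space (PiM {1..n} (\<lambda>_. M)) \<Longrightarrow> \<bar>f y\<bar> \<le> B"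
    and \<mu>: "prob_space \<mu>" "sets \<mu> = sets M" and "n \<le> m"
  shows "ereal (\<integral>y. f y \<partial>PiM {1..n} (\<lambda>_. \<mu>)) \<le> sup_injection_average M n f m"
proof (rule ccontr)
  let ?P = "\<lambda>k. PiM {1..k::nat} (\<lambda>_. \<mu>)"
  assume less: "\<not> ?thesis"
  have sets_eq: "sets (?P k) = sets (PiM {1..k} (\<lambda>_. M))" for k
    by (intro sets_PiM_cong \<mu> refl)
  have space_eq: "space (?P k) = space (PiM {1..k} (\<lambda>_. M))" for k
    by (rule sets_eq_imp_space_eq[OF sets_eq])
  interpret P: prob_space "?P m"
    by (intro prob_space_PiM \<mu>)
  have f': "f \<in> borel_measurable (?P n)"
    using f by (subst measurable_cong_sets[OF sets_eq refl])
  define E where "E = (\<integral>y. f y \<partial>?P n)"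
  define D where "D = (\<Prod>k<n. real m - real k)"
  have D: "D > 0" "real (card (injections n m)) = D"
    unfolding D_def using \<open>n \<le> m\<close> by (simp_all add: falling_factorial_pos card_injections)
  have pull: "has_bochner_integral (?P m) (\<lambda>x. f (\<lambda>k\<in>{1..n}. x (i k))) E"
    if "i \<in> injections n m" for i
  proof -
    have i: "inj_on i {1..n}" "i \<in> {1..n} \<rightarrow> {1..m}"
      using that by (auto simp: injections_def PiE_iff)
    have meas: "(\<lambda>x. \<lambda>k\<in>{1..n}. x (i k)) \<in> measurable (?P m) (?P n)"
      using i(2) by (intro measurable_restrict measurable_component_singleton) auto
    \<comment> \<open>Injectivity of \<open>i\<close> is what makes this work: a repeated index
      would give two identical coordinates instead of independent ones.\<close>
    have distr: "distr (?P m) (?P n) (\<lambda>x. \<lambda>k\<in>{1..n}. x (i k)) = ?P n"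
      using distr_PiM_reindex[of "{1..m}" "\<lambda>_. \<mu>" i "{1..n}"] i \<mu>(1) by simp
    have "integrable (?P m) (\<lambda>x. f (\<lambda>k\<in>{1..n}. x (i k)))"
    proof (rule P.integrable_const_bound[of _ B])
      show "AE x in ?P m. norm (f (\<lambda>k\<in>{1..n}. x (i k))) \<le> B"
        unfolding real_norm_def using restrict_comp_in_space_PiM[OF _ i(2), of _ M]
        by (intro AE_I2 B) (simp only: space_eq)
    qed (rule measurable_compose[OF meas f'])
    moreover have "(\<integral>x. f (\<lambda>k\<in>{1..n}. x (i k)) \<partial>?P m) = E"
      using integral_distr[OF meas f'] unfolding E_def distr by (rule sym)
    ultimately show ?thesis
      by (simp add: has_bochner_integral_iff)
  qed
  have "has_bochner_integral (?P m)
      (\<lambda>x. 1 / D * (\<Sum>i\<in>injections n m. f (\<lambda>k\<in>{1..n}. x (i k))))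
      (1 / D * (\<Sum>i\<in>injections n m. E))"
    by (intro has_bochner_integral_mult_right has_bochner_integral_sum pull)
  \<comment> \<open>There are exactly \<open>D\<close> injections, so the normalised sum of the
    constant \<open>E\<close> is \<open>E\<close>.\<close>
  then have avg: "has_bochner_integral (?P m) (injection_average n f m) E"
    using D \<open>n \<le> m\<close> by (simp add: injection_average_def[abs_def] D_def)
  have "injection_average n f m x < E" if "x \<in> space (?P m)" for x
  proof -
    have "ereal (injection_average n f m x) \<le> sup_injection_average M n f m"
      unfolding sup_injection_average_def using that by (intro SUP_upper) (simp only: space_eq)
    also have "\<dots> < ereal E" using less by (simp add: E_def)
    finally show ?thesis by simp
  qed
  \<comment> \<open>Pointwise strictness survives integration because the whole space has mass 1,
    not 0.\<close>
  then have "(\<integral>x. injection_average n f m x \<partial>?P m) < (\<integral>x. E \<partial>?P m)"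
    by (intro P.integral_less_AE_space AE_I2 P.integrable_const integrable.intros[OF avg])
      (simp_all only: P.emeasure_space_1, simp)
  then show False
    unfolding has_bochner_integral_integral_eq[OF avg] lebesgue_integral_const P.prob_space by simp
qed

section \<open>Empirical measures and the error bound\<close>

text \<open>\<open>\<mu>\<close> is the empirical measure of \<open>x\<close>, the law of
  \<open>x\<close> at a uniformly random index. Its power is the image of the uniform measure on
  index maps under composition with \<open>x\<close>, so the integral becomes a finite sum.\<close>

lemma product_expectation_empirical:
  fixes f :: "(nat \<Rightarrow> 'a) \<Rightarrow> real"
  assumes f: "f \<in> borel_measurable (PiM {1..n} (\<lambda>_. M))"
    and x: "x \<in> space (PiM {1..m} (\<lambda>_. M))" and "m \<ge> 1"
  defines "\<mu> \<equiv> distr (uniform_count_measure {1..m}) M x"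
  shows "(\<integral>y. f y \<partial>PiM {1..n} (\<lambda>_. \<mu>)) =
      (\<Sum>i\<in>{1..n} \<rightarrow>\<^sub>E {1..m}. f (\<lambda>k\<in>{1..n}. x (i k))) / real m ^ n"
    and "prob_space \<mu>" and "sets \<mu> = sets M"
proof -
  let ?U = "uniform_count_measure {1..m}"
  interpret U: prob_space ?U
    using \<open>m \<ge> 1\<close> by (intro prob_space_uniform_count_measure) auto
  have meas: "x \<in> measurable ?U M"
    using x by (subst measurable_cong_sets[OF sets_uniform_count_measure_count_space refl])
      (auto simp: space_PiM PiE_iff)
  show sets: "sets \<mu> = sets M" by (simp add: \<mu>_def)
  show prob: "prob_space \<mu>" unfolding \<mu>_def by (rule U.prob_space_distr[OF meas])
  \<comment> \<open>The target is changed from \<open>M\<close> to \<open>\<mu>\<close>, which has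
    the same measurable sets, so that the image measure can be formed over the power of
    \<open>\<mu>\<close> itself.\<close>
  have meas': "x \<in> measurable ?U \<mu>"
    using meas by (simp add: measurable_cong_sets[OF refl sets])
  have f': "f \<in> borel_measurable (PiM {1..n} (\<lambda>_. \<mu>))"
    using f by (subst measurable_cong_sets[OF sets_PiM_cong[OF refl sets] refl])
  have comp: "compose {1..n} x \<in> measurable (PiM {1..n} (\<lambda>_. ?U)) (PiM {1..n} (\<lambda>_. \<mu>))"
    unfolding compose_def
    by (intro measurable_restrict measurable_compose[OF _ meas'] measurable_component_singleton)
  have "distr ?U \<mu> x = \<mu>"
    unfolding \<mu>_def by (intro distr_cong) auto
  moreover have "distr (PiM {1..n} (\<lambda>_. ?U)) (PiM {1..n} (\<lambda>_. \<mu>)) (compose {1..n} x) =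
      PiM {1..n} (\<lambda>_. distr ?U \<mu> x)"
    using meas' prob U.prob_space_axioms by (intro distr_PiM_finite_prob_space') auto
  ultimately have "PiM {1..n} (\<lambda>_. \<mu>) =
      distr (PiM {1..n} (\<lambda>_. ?U)) (PiM {1..n} (\<lambda>_. \<mu>)) (compose {1..n} x)"
    by simp
  then have "(\<integral>y. f y \<partial>PiM {1..n} (\<lambda>_. \<mu>)) =
      (\<integral>i. f (compose {1..n} x i) \<partial>PiM {1..n} (\<lambda>_. ?U))"
    using integral_distr[OF comp f'] by simp
  also have "PiM {1..n} (\<lambda>_. ?U) = uniform_count_measure ({1..n} \<rightarrow>\<^sub>E {1..m})"
    using \<open>m \<ge> 1\<close> by (intro PiM_uniform_count_measure) auto
  also have "(\<integral>i. f (compose {1..n} x i) \<partial>\<dots>) =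
      (\<Sum>i\<in>{1..n} \<rightarrow>\<^sub>E {1..m}. f (compose {1..n} x i)) / real m ^ n"
    by (simp add: integral_uniform_count_measure finite_PiE card_funcsetE)
  finally show "(\<integral>y. f y \<partial>PiM {1..n} (\<lambda>_. \<mu>)) =
      (\<Sum>i\<in>{1..n} \<rightarrow>\<^sub>E {1..m}. f (\<lambda>k\<in>{1..n}. x (i k))) / real m ^ n"
    unfolding compose_def .
qed

text \<open>Split the \<open>N\<close> maps into the \<open>D\<close> injections, with sum
  \<open>S\<close>, and the rest, with sum \<open>R\<close>. Two errors occur: \<open>S\<close> is
  divided by \<open>D\<close> instead of \<open>N\<close>, and \<open>R\<close> is left out. Each
  costs at most \<open>B * (1 - D / N)\<close>, whence the factor 2.\<close>

lemma injection_average_le_empirical: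
  fixes f :: "(nat \<Rightarrow> 'a) \<Rightarrow> real"
  assumes B: "\<And>y. y \<in> space (PiM {1..n} (\<lambda>_. M)) \<Longrightarrow> \<bar>f y\<bar> \<le> B"
    and x: "x \<in> space (PiM {1..m} (\<lambda>_. M))" and "n \<le> m" "m \<ge> 1"
  shows "injection_average n f m x \<le>
    (\<Sum>i\<in>{1..n} \<rightarrow>\<^sub>E {1..m}. f (\<lambda>k\<in>{1..n}. x (i k))) / real m ^ n
      + 2 * B * (1 - (\<Prod>k<n. real m - real k) / real m ^ n)"
proof -
  let ?A = "{1..n} \<rightarrow>\<^sub>E {1..m}" and ?g = "\<lambda>i. f (\<lambda>k\<in>{1..n}. x (i k))"
  define D where "D = (\<Prod>k<n. real m - real k)"
  define N where "N = real m ^ n"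
  define S where "S = (\<Sum>i\<in>injections n m. ?g i)"
  define R where "R = (\<Sum>i\<in>?A - injections n m. ?g i)"
  have fin: "finite ?A" by (intro finite_PiE) auto
  have sub: "injections n m \<subseteq> ?A" by (auto simp: injections_def)
  have card: "real (card (injections n m)) = D" "real (card ?A) = N"
    unfolding D_def N_def using \<open>n \<le> m\<close> by (simp_all add: card_injections card_funcsetE)
  have pos: "D > 0" "N > 0"
    unfolding D_def N_def using \<open>n \<le> m\<close> \<open>m \<ge> 1\<close> by (auto intro!: falling_factorial_pos)
  have DN: "D \<le> N" unfolding card[symmetric] using sub fin by (simp add: card_mono)
  have g: "\<bar>?g i\<bar> \<le> B" if "i \<in> ?A" for i
    using that x by (intro B restrict_comp_in_space_PiM) (auto simp: PiE_iff)
  have "S \<le> (\<Sum>i\<in>injections n m. B)"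
    unfolding S_def using g sub by (intro sum_mono) (meson abs_le_D1 subsetD)
  then have "S / D \<le> B" using pos card by (simp add: field_simps)
  then have "S / D * (1 - D / N) \<le> B * (1 - D / N)"
    using pos DN by (intro mult_right_mono) auto
  moreover have "-R \<le> (N - D) * B"
  proof -
    have "-R \<le> (\<Sum>i\<in>?A - injections n m. B)"
      unfolding R_def sum_negf[symmetric] using g by (intro sum_mono) (meson DiffD1 abs_le_D2)
    also have "\<dots> = (N - D) * B"
      using card DN sub fin by (simp add: card_Diff_subset of_nat_diff card_mono)
    finally show ?thesis .
  qed
  then have "-R / N \<le> B * (1 - D / N)"
    using pos by (simp add: field_simps)
  moreover have "(\<Sum>i\<in>?A. ?g i) / N = (S + R) / N"
    unfolding S_def R_def using sum.subset_diff[OF sub fin, of ?g] by simp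
  \<comment> \<open>The second summand is the change of normalisation of \<open>S\<close>; the last
    one removes the noninjective maps.\<close>
  moreover have "S / D = (S + R) / N + S / D * (1 - D / N) - R / N"
    using pos by (simp add: field_simps)
  moreover have "injection_average n f m x = S / D"
    by (simp add: injection_average_def S_def D_def)
  moreover have "2 * B * (1 - D / N) = B * (1 - D / N) + B * (1 - D / N)"
    by simp
  ultimately have "injection_average n f m x \<le> (\<Sum>i\<in>?A. ?g i) / N + 2 * B * (1 - D / N)"
    by linarith
  then show ?thesis
    unfolding D_def N_def .
qed

section \<open>Passage to the limit\<close>

text \<open>The number \<open>n\<close> of factors is fixed, and each factor
  \<open>1 - k / m\<close> tends to 1.\<close>

lemma falling_factorial_over_power_tendsto:
  "(\<lambda>m. (\<Prod>k<n. real m - real k) / real m ^ n) \<longlonglongrightarrow> 1"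
proof -
  have "(\<lambda>m. (real m - real k) / real m) \<longlonglongrightarrow> 1" for k
    by real_asymp
  then have "(\<lambda>m. \<Prod>k<n. (real m - real k) / real m) \<longlonglongrightarrow> (\<Prod>k<n. 1)"
    by (intro tendsto_prod)
  then show ?thesis by (simp add: prod_dividef)
qed

theorem theorem2p4:
  fixes M :: "'a measure" and n :: nat and f :: "(nat \<Rightarrow> 'a) \<Rightarrow> real"
  assumes "n \<ge> 1"
    and "f \<in> borel_measurable (PiM {1..n} (\<lambda>_. M))"
    and "bounded (f ` space (PiM {1..n} (\<lambda>_. M)))"
  shows "antimono_on {n..} (sup_injection_average M n f)
    \<and> sup_injection_average M n f \<longlonglongrightarrow> sup_product_expectation M n f"
proof
  show "antimono_on {n..} (sup_injection_average M n f)"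
    by (rule antimono_sup_injection_average)
  obtain B where B: "\<And>y. y \<in> space (PiM {1..n} (\<lambda>_. M)) \<Longrightarrow> \<bar>f y\<bar> \<le> B"
    using assms(3) by (auto simp: bounded_iff)
  define L where "L = sup_product_expectation M n f"
  define e where "e m = 2 * B * (1 - (\<Prod>k<n. real m - real k) / real m ^ n)" for m
  have lower: "L \<le> sup_injection_average M n f m" if "m \<ge> n" for m
    unfolding L_def sup_product_expectation_def
    using product_expectation_le_sup_injection_average[of f n M B, OF assms(2) B] that
    by (intro SUP_least) auto
  \<comment> \<open>The error \<open>e m\<close> does not depend on \<open>x\<close>, so the
    pointwise bound passes to the supremum over \<open>x\<close>.\<close>
  have upper: "sup_injection_average M n f m \<le> L + ereal (e m)" if "m \<ge> n" for m
    unfolding sup_injection_average_def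
  proof (rule SUP_least)
    fix x assume x: "x \<in> space (PiM {1..m} (\<lambda>_. M))"
    \<comment> \<open>Here \<open>n \<ge> 1\<close> enters: it excludes \<open>m = 0\<close>, where
      there is no empirical measure.\<close>
    have m: "m \<ge> 1" using that assms(1) by simp
    define \<mu> where "\<mu> = distr (uniform_count_measure {1..m}) M x"
    note emp = product_expectation_empirical[OF assms(2) x m, folded \<mu>_def]
    have "ereal (injection_average n f m x) \<le> ereal ((\<integral>y. f y \<partial>PiM {1..n} (\<lambda>_. \<mu>)) + e m)"
      using injection_average_le_empirical[of n M f B x m, OF B x that m] by (simp only: emp(1) e_def ereal_less_eq)
    also have "\<dots> = ereal (\<integral>y. f y \<partial>PiM {1..n} (\<lambda>_. \<mu>)) + ereal (e m)"
      by simp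
    also have "\<dots> \<le> L + ereal (e m)"
      unfolding L_def sup_product_expectation_def using emp(2,3)
      by (intro add_right_mono SUP_upper) simp
    finally show "ereal (injection_average n f m x) \<le> L + ereal (e m)" .
  qed
  have "e \<longlonglongrightarrow> 2 * B * (1 - 1)"
    unfolding e_def by (intro tendsto_intros falling_factorial_over_power_tendsto)
  \<comment> \<open>\<open>L\<close> is \<open>-\<infinity>\<close> when \<open>space M\<close> is
    empty, so the limit rule for sums is one that requires only the limit of \<open>e\<close> to be
    finite.\<close>
  then have "(\<lambda>m. L + ereal (e m)) \<longlonglongrightarrow> L + ereal 0"
    by (intro tendsto_add_ereal_general1) auto
  then have lim: "(\<lambda>m. L + ereal (e m)) \<longlonglongrightarrow> L"
    by simp
  show "sup_injection_average M n f \<longlonglongrightarrow> sup_product_expectation M n f"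
    unfolding L_def[symmetric]
  \<comment> \<open>Both bounds are available from \<open>m = n\<close> on, which suffices for the
    limit.\<close>
  proof (rule tendsto_sandwich[OF _ _ tendsto_const lim])
    show "\<forall>\<^sub>F m in sequentially. L \<le> sup_injection_average M n f m"
      using lower by (auto simp: eventually_sequentially)
    show "\<forall>\<^sub>F m in sequentially. sup_injection_average M n f m \<le> L + ereal (e m)"
      using upper by (auto simp: eventually_sequentially)
  qed
qed

end
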